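(* Let $f\in\mathbb{C}[z_1,\ldots,z_n]$ be multi-affine, let $C\subset\mathbb{C}$ be an open or closed circular domain, let $0\le p\le 1$, and let $\tau=(ij)\in\mathfrak{S}_n$ be a transposition. (a) If $C$ is convex and $f$ is $C$-stable, then $pf+(1-p)\tau(f)$ is $C$-stable. (b) If $C$ is non-convex and $f$ is $C$-stable and depends on both $z_i$ and $z_j$, then $pf+(1-p)\tau(f)$ is $C$-stable.
   Context: A circular domain in $\mathbb{C}$ is any open or closed disk, exterior of a disk, or half-plane. A polynomial $f\in\mathbb{C}[z_1,\ldots,z_n]$ is $C$-stable if $f(z_1,\ldots,z_n)\neq 0$ whenever $z_1,\ldots,z_n\in C$. A polynomial is multi-affine if it has degree at most $1$ in each variable. The symmetric group $\mathfrak{S}_n$ acts by $\sigma(f)(z_1,\ldots,z_n)=f(z_{\sigma(1)},\ldots,z_{\sigma(n)})$. "$f$ depends on $z_i$" means $\partial f/\partial z_i\not\equiv 0$. *)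

theory Defs
  imports
    "HOL-Analysis.Analysis"
    "HOL-Library.Poly_Mapping"
    "HOL-Combinatorics.Transposition"
begin

text \<open>
  Complex polynomials in variables indexed by a finite type \<open>'n\<close>: a monomial is an exponent
  vector, and a polynomial maps finitely many monomials to nonzero coefficients. Ring structure
  (convolution product) is the one of theory \<open>Poly_Mapping\<close>.
\<close>

type_synonym 'n monomial = "'n \<Rightarrow>\<^sub>0 nat"
type_synonym 'n cpoly = "'n monomial \<Rightarrow>\<^sub>0 complex"

definition const :: "complex \<Rightarrow> 'n cpoly" where
  "const c = Poly_Mapping.single 0 c"

definition monom_eval :: "'n::finite monomial \<Rightarrow> ('n \<Rightarrow> complex) \<Rightarrow> complex" where
  "monom_eval m z = (\<Prod>i\<in>UNIV. z i ^ Poly_Mapping.lookup m i)"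

definition cpoly_eval :: "'n::finite cpoly \<Rightarrow> ('n \<Rightarrow> complex) \<Rightarrow> complex" where
  "cpoly_eval f z = (\<Sum>m\<in>Poly_Mapping.keys f. Poly_Mapping.lookup f m * monom_eval m z)"

definition degree_in :: "'n \<Rightarrow> 'n cpoly \<Rightarrow> nat" where
  "degree_in i f = Max (insert 0 ((\<lambda>m. Poly_Mapping.lookup m i) ` Poly_Mapping.keys f))"

definition multi_affine :: "'n cpoly \<Rightarrow> bool" where
  "multi_affine f \<longleftrightarrow> (\<forall>i. degree_in i f \<le> 1)"

text \<open>
  In monomials where the variable does not occur, the truncated exponent is harmless because
  the coefficient \<open>of_nat (lookup m i)\<close> vanishes.
\<close>

definition partial_deriv :: "'n \<Rightarrow> 'n cpoly \<Rightarrow> 'n cpoly" where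
  "partial_deriv i f =
     (\<Sum>m\<in>Poly_Mapping.keys f.
        Poly_Mapping.single (m - Poly_Mapping.single i 1)
          (of_nat (Poly_Mapping.lookup m i) * Poly_Mapping.lookup f m))"

definition depends_on :: "'n cpoly \<Rightarrow> 'n \<Rightarrow> bool" where
  "depends_on f i \<longleftrightarrow> partial_deriv i f \<noteq> 0"

text \<open>
  The action of \<open>\<sigma>\<close> substitutes \<open>z\<^bsub>\<sigma> i\<^esub>\<close> for \<open>z\<^sub>i\<close>; lemma \<open>cpoly_eval_permute_vars\<close>
  below confirms the convention.
\<close>

definition permute_monom :: "('n \<Rightarrow> 'n) \<Rightarrow> 'n::finite monomial \<Rightarrow> 'n monomial" where
  "permute_monom \<sigma> m = (\<Sum>i\<in>UNIV. Poly_Mapping.single (\<sigma> i) (Poly_Mapping.lookup m i))"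

definition permute_vars :: "('n \<Rightarrow> 'n) \<Rightarrow> 'n::finite cpoly \<Rightarrow> 'n cpoly" where
  "permute_vars \<sigma> f =
     (\<Sum>m\<in>Poly_Mapping.keys f.
        Poly_Mapping.single (permute_monom \<sigma> m) (Poly_Mapping.lookup f m))"

text \<open>
  Disks are nondegenerate (positive radius). The exterior of a closed disk is open and that of
  an open disk is closed. With the real inner product on the complex plane, \<open>w \<bullet> z\<close>
  is the real part of \<open>cnj w * z\<close>.
\<close>

definition circular_domain :: "complex set \<Rightarrow> bool" where
  "circular_domain C \<longleftrightarrow>
     (\<exists>a r. 0 < r \<and> (C = ball a r \<or> C = cball a r \<or> C = - cball a r \<or> C = - ball a r)) \<or>
     (\<exists>w b. w \<noteq> 0 \<and> (C = {z. w \<bullet> z > b} \<or> C = {z. w \<bullet> z \<ge> b}))"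

definition stable_on :: "complex set \<Rightarrow> 'n::finite cpoly \<Rightarrow> bool" where
  "stable_on C f \<longleftrightarrow> (\<forall>z. (\<forall>k. z k \<in> C) \<longrightarrow> cpoly_eval f z \<noteq> 0)"

lemma cpoly_eval_superset:
  assumes "finite A" "Poly_Mapping.keys f \<subseteq> A"
  shows "cpoly_eval f z = (\<Sum>m\<in>A. Poly_Mapping.lookup f m * monom_eval m z)"
  unfolding cpoly_eval_def
  by (rule sum.mono_neutral_left) (use assms in \<open>auto simp: in_keys_iff\<close>)

lemma cpoly_eval_zero [simp]: "cpoly_eval 0 z = 0"
  by (simp add: cpoly_eval_def)

lemma cpoly_eval_add: "cpoly_eval (f + g) z = cpoly_eval f z + cpoly_eval g z"
proof -
  let ?A = "Poly_Mapping.keys f \<union> Poly_Mapping.keys g"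
  have "Poly_Mapping.keys (f + g) \<subseteq> ?A"
    by (rule Poly_Mapping.keys_add)
  then show ?thesis
    by (simp add: cpoly_eval_superset[of ?A] lookup_add distrib_right sum.distrib)
qed

lemma cpoly_eval_sum: "cpoly_eval (\<Sum>x\<in>A. g x) z = (\<Sum>x\<in>A. cpoly_eval (g x) z)"
  by (induction A rule: infinite_finite_induct) (simp_all add: cpoly_eval_add)

lemma cpoly_eval_single: "cpoly_eval (Poly_Mapping.single m c) z = c * monom_eval m z"
  by (cases "c = 0") (simp_all add: cpoly_eval_def)

lemma monom_eval_zero [simp]: "monom_eval 0 z = 1"
  by (simp add: monom_eval_def)

lemma monom_eval_add: "monom_eval (m + m') z = monom_eval m z * monom_eval m' z"
  by (simp add: monom_eval_def lookup_add power_add prod.distrib)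

lemma monom_eval_sum: "monom_eval (\<Sum>x\<in>A. g x) z = (\<Prod>x\<in>A. monom_eval (g x) z)"
  by (induction A rule: infinite_finite_induct) (simp_all add: monom_eval_add)

lemma monom_eval_single: "monom_eval (Poly_Mapping.single i k) z = z i ^ k"
proof -
  have "monom_eval (Poly_Mapping.single i k) z = (\<Prod>j\<in>UNIV. if i = j then z i ^ k else 1)"
    unfolding monom_eval_def
    by (rule prod.cong) (auto simp: lookup_single when_def)
  then show ?thesis
    by simp
qed

lemma cpoly_eval_permute_vars: "cpoly_eval (permute_vars \<sigma> f) z = cpoly_eval f (\<lambda>i. z (\<sigma> i))"
proof -
  have "monom_eval (permute_monom \<sigma> m) z = monom_eval m (\<lambda>i. z (\<sigma> i))" for m
    by (simp add: permute_monom_def monom_eval_sum monom_eval_single) (simp add: monom_eval_def)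
  then show ?thesis
    by (simp add: permute_vars_def cpoly_eval_sum cpoly_eval_single) (simp add: cpoly_eval_def)
qed

lemma poly_mapping_eq_sum_single:
  "f = (\<Sum>m\<in>Poly_Mapping.keys f. Poly_Mapping.single m (Poly_Mapping.lookup f m))"
  by (rule poly_mapping_eqI)
     (simp add: lookup_sum lookup_single when_def in_keys_iff)

lemma cpoly_eval_mult: "cpoly_eval (f * g) z = cpoly_eval f z * cpoly_eval g z"
proof -
  have "f * g = (\<Sum>m\<in>Poly_Mapping.keys f. \<Sum>m'\<in>Poly_Mapping.keys g.
      Poly_Mapping.single (m + m') (Poly_Mapping.lookup f m * Poly_Mapping.lookup g m'))"
    by (subst poly_mapping_eq_sum_single[of f], subst poly_mapping_eq_sum_single[of g])
       (simp add: sum_product mult_single)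
  then have "cpoly_eval (f * g) z = (\<Sum>m\<in>Poly_Mapping.keys f. \<Sum>m'\<in>Poly_Mapping.keys g.
      (Poly_Mapping.lookup f m * monom_eval m z) * (Poly_Mapping.lookup g m' * monom_eval m' z))"
    by (simp add: cpoly_eval_sum cpoly_eval_single monom_eval_add mult.assoc mult.left_commute)
  then show ?thesis
    by (simp add: cpoly_eval_def sum_product)
qed

lemma cpoly_eval_const [simp]: "cpoly_eval (const c) z = c"
  by (simp add: const_def cpoly_eval_single)

end

theory Submission
  imports Defs
begin

text \<open>
  Fixing all variables except \<open>z\<^sub>i = x\<close> and \<open>z\<^sub>j = y\<close> turns \<open>f\<close> into
  \<open>g x y = a + b x + c y + d x y\<close>. A zero of the mixture means
  \<open>p * g x y + (1 - p) * g y x = 0\<close>, so what has to be excluded is that the ratio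
  \<open>g y x / g x y\<close> is a negative real \<open>- \<rho>\<close> for some \<open>x, y \<in> C\<close>; this is
  \<open>biaffine_swap_ratio_not_negative\<close>.

  To exclude it, the pair \<open>(x, y)\<close> is moved to \<open>(y, x)\<close> inside \<open>C\<close>: for a suitable constant \<open>l\<close>,
  the Moebius transformation \<open>M s = (l s x + y) / (l s + 1)\<close> takes \<open>\<infinity>, 0\<close> to \<open>x, y\<close>
  and maps the half-plane \<open>Re s \<ge> 0\<close> into \<open>C\<close>. Clearing denominators in \<open>g (M s) (M (1 / s))\<close>
  leaves the quadratic polynomial
  \<open>l * g x y * s\<^sup>2 + (l\<^sup>2 * g x x + g y y) * s + l * g y x\<close>. The product of its two roots is
  the ratio in question. If that product is \<open>- \<rho>\<close>, the roots are \<open>s\<close> and \<open>- \<rho> / s\<close>, so one of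
  them has nonnegative real part, and it yields a zero of \<open>g\<close> with both
  coordinates in \<open>C\<close>.

  That \<open>M\<close> can be chosen uniformly for disks, exteriors of disks and half-planes comes from
  describing \<open>C\<close> by a Hermitian form in homogeneous coordinates: the value of the form at a
  combination \<open>\<alpha> x + \<beta> y\<close> is nonnegative as soon as the polarized form contributes a
  nonnegative cross term, and this is arranged by the phase of \<open>l\<close>. The modulus of \<open>l\<close> remains
  free, and a generic choice avoids coincidences at the point at infinity.

  The point at infinity is the only place where convexity matters. A disk stays away from it,
  and a half-plane only touches it. For the exterior of a disk, \<open>M s\<close> may be infinite, and then
  the value of \<open>g\<close> is replaced by a leading coefficient \<open>b + d m\<close> or \<open>c + d m\<close> with \<open>m \<in> C\<close>.
  These are values of \<open>\<partial>f/\<partial>z\<^sub>i\<close> and \<open>\<partial>f/\<partial>z\<^sub>j\<close> on \<open>C\<close>, and \<open>slope_nonzero_on_unbounded\<close>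
  shows that they do not vanish when \<open>f\<close> depends on both variables.
\<close>

section \<open>Disks and half-planes as positivity sets of Hermitian forms\<close>

text \<open>
  The Hermitian form with matrix entries \<open>A\<close>, \<open>w / 2\<close>, \<open>D\<close> in homogeneous coordinates
  \<open>u / v\<close> of a point. Its value at \<open>v = 0\<close> is governed by \<open>A\<close>, whose sign therefore tells on which
  side of the boundary circle the point at infinity lies.
\<close>

definition circ_form :: "real \<Rightarrow> complex \<Rightarrow> real \<Rightarrow> complex \<Rightarrow> complex \<Rightarrow> real" where
  "circ_form A w D u v = A * (cmod u)\<^sup>2 + Re (cnj w * u * cnj v) + D * (cmod v)\<^sup>2"

text \<open>The polarization of the form, at the representatives \<open>(x, 1)\<close> and \<open>(y, 1)\<close>.\<close>

definition circ_polar :: "real \<Rightarrow> complex \<Rightarrow> real \<Rightarrow> complex \<Rightarrow> complex \<Rightarrow> complex" where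
  "circ_polar A w D x y = of_real A * x * cnj y + (cnj w * x + w * cnj y) / 2 + of_real D"

lemma circ_form_combination:
  "circ_form A w D (\<alpha> * x + \<beta> * y) (\<alpha> + \<beta>) =
     (cmod \<alpha>)\<^sup>2 * circ_form A w D x 1 + (cmod \<beta>)\<^sup>2 * circ_form A w D y 1
     + 2 * Re (\<alpha> * cnj \<beta> * circ_polar A w D x y)"
  unfolding circ_form_def circ_polar_def cmod_power2
  by (simp add: power2_eq_square field_simps)

lemma circ_form_scale: "circ_form A w D (c * u) (c * v) = (cmod c)\<^sup>2 * circ_form A w D u v"
  unfolding circ_form_def cmod_power2
  by (simp add: power2_eq_square algebra_simps)

lemma circ_form_dehomogenize:
  assumes "v \<noteq> 0"
  shows "circ_form A w D u v = (cmod v)\<^sup>2 * circ_form A w D (u / v) 1"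
  using circ_form_scale[of A w D v "u / v" 1] assms by simp

definition circ_region :: "real \<Rightarrow> complex \<Rightarrow> real \<Rightarrow> complex set \<Rightarrow> bool" where
  "circ_region A w D C \<longleftrightarrow> (A = 0 \<longrightarrow> w \<noteq> 0) \<and>
     (C = {z. circ_form A w D z 1 > 0} \<or> C = {z. circ_form A w D z 1 \<ge> 0})"

lemma not_convex_exterior:
  fixes a :: complex
  assumes "0 < r" "C = - cball a r \<or> C = - ball a r"
  shows "\<not> convex C"
proof
  assume c: "convex C"
  have "a + of_real (2 * r) \<in> C" "a - of_real (2 * r) \<in> C"
    using assms by (auto simp: dist_norm)
  then have "(1/2::real) *\<^sub>R (a + of_real (2 * r)) + (1/2::real) *\<^sub>R (a - of_real (2 * r)) \<in> C"
    by (intro convexD[OF c]) auto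
  moreover have "(1/2::real) *\<^sub>R (a + of_real (2 * r)) + (1/2::real) *\<^sub>R (a - of_real (2 * r)) = a"
    by (simp add: complex_eq_iff field_simps)
  ultimately show False
    using assms by auto
qed

lemma islimpt_exterior:
  fixes a x :: complex
  assumes r: "0 < r" and C: "C = - cball a r \<or> C = - ball a r" and x: "x \<in> C"
  shows "x islimpt C"
  unfolding islimpt_approachable
proof (intro allI impI)
  fix e :: real
  assume "e > 0"
  define n where "n = cmod (x - a)"
  have n: "n > 0"
    using C x r by (auto simp: n_def dist_norm)
  define t where "t = e / (2 * n)"
  have t: "t > 0"
    using n \<open>e > 0\<close> by (simp add: t_def)
  \<comment> \<open>Moving radially away from the centre stays in the exterior.\<close>
  let ?y = "x + of_real t * (x - a)"
  have "?y - a = of_real (1 + t) * (x - a)"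
    by (simp add: algebra_simps)
  then have "cmod (?y - a) = (1 + t) * n"
    using t by (simp add: n_def norm_mult del: of_real_add)
  then have "cmod (?y - a) > n"
    using t n by simp
  then have "?y \<in> C"
    using C x by (auto simp: dist_norm n_def norm_minus_commute)
  moreover have "dist ?y x = e / 2"
    using t n by (simp add: dist_norm norm_mult n_def[symmetric]) (simp add: t_def)
  ultimately show "\<exists>y\<in>C. y \<noteq> x \<and> dist y x < e"
    using \<open>e > 0\<close> by (intro bexI[of _ ?y]) auto
qed

lemma circular_domain_cases:
  assumes "circular_domain C"
  obtains (convex) A w D where "circ_region A w D C" "A \<le> 0" "convex C"
  | (exterior) A w D a r where "circ_region A w D C" "0 < r" "C = - cball a r \<or> C = - ball a r"
      "\<not> convex C"
proof -
  have disk: "circ_form (-1) (2 * a) (r\<^sup>2 - (cmod a)\<^sup>2) z 1 = r\<^sup>2 - (dist a z)\<^sup>2"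
    and ext: "circ_form 1 (- 2 * a) ((cmod a)\<^sup>2 - r\<^sup>2) z 1 = (dist a z)\<^sup>2 - r\<^sup>2" for a z r
    unfolding circ_form_def dist_norm cmod_power2
    by (simp_all add: power2_eq_square algebra_simps)
  have half: "circ_form 0 w (- b) z 1 = w \<bullet> z - b" for w z b
    unfolding circ_form_def by (simp add: inner_complex_def)
  have less: "(dist a z)\<^sup>2 < r\<^sup>2 \<longleftrightarrow> dist a z < r" and le: "(dist a z)\<^sup>2 \<le> r\<^sup>2 \<longleftrightarrow> dist a z \<le> r"
    if "r > 0" for a z :: complex and r
    using that power_mono_iff[of "dist a z" r 2] power_mono_iff[of r "dist a z" 2]
    by (simp_all add: not_le[symmetric])
  consider (b) a r where "0 < r" "C = ball a r \<or> C = cball a r"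
    | (e) a r where "0 < r" "C = - cball a r \<or> C = - ball a r"
    | (h) w b where "w \<noteq> 0" "C = {z. w \<bullet> z > b} \<or> C = {z. w \<bullet> z \<ge> b}"
    using assms unfolding circular_domain_def by blast
  then show ?thesis
  proof cases
    case b
    have "circ_region (-1) (2 * a) (r\<^sup>2 - (cmod a)\<^sup>2) C"
      using b(2) unfolding circ_region_def disk by (auto simp: less le b(1))
    moreover have "convex C"
      using b(2) by auto
    ultimately show ?thesis
      using convex by force
  next
    case e
    have "circ_region 1 (- 2 * a) ((cmod a)\<^sup>2 - r\<^sup>2) C"
      using e(2) unfolding circ_region_def ext
      by (auto simp: not_le not_less less[OF e(1), symmetric] le[OF e(1), symmetric])
    then show ?thesis
      using exterior e not_convex_exterior by blast
  next
    case h
    have "circ_region 0 w (- b) C"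
      using h unfolding circ_region_def half by auto
    moreover have "convex C"
      using h(2) by (auto intro: convex_halfspace_gt convex_halfspace_ge)
    ultimately show ?thesis
      using convex by force
  qed
qed

text \<open>
  Both the positive and the nonnegative cone of a Hermitian form are closed under those
  combinations of two members for which the cross term is nonnegative.
\<close>

lemma circ_region_combination:
  assumes C: "circ_region A w D C" and "x \<in> C" "y \<in> C"
    and ab: "\<alpha> + \<beta> \<noteq> 0" and Re: "Re (\<alpha> * cnj \<beta> * circ_polar A w D x y) \<ge> 0"
  shows "(\<alpha> * x + \<beta> * y) / (\<alpha> + \<beta>) \<in> C"
proof -
  let ?Q = "\<lambda>z. circ_form A w D z 1"
  have eq: "(cmod (\<alpha> + \<beta>))\<^sup>2 * ?Q ((\<alpha> * x + \<beta> * y) / (\<alpha> + \<beta>)) =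
      (cmod \<alpha>)\<^sup>2 * ?Q x + (cmod \<beta>)\<^sup>2 * ?Q y + 2 * Re (\<alpha> * cnj \<beta> * circ_polar A w D x y)"
    using circ_form_dehomogenize[OF ab] circ_form_combination by metis
  have pos: "(cmod (\<alpha> + \<beta>))\<^sup>2 > 0"
    using ab by simp
  consider "C = {z. ?Q z > 0}" | "C = {z. ?Q z \<ge> 0}"
    using C unfolding circ_region_def by blast
  then show ?thesis
  proof cases
    case 1
    then have Q: "?Q x > 0" "?Q y > 0"
      using assms by auto
    have "\<alpha> \<noteq> 0 \<or> \<beta> \<noteq> 0"
      using ab by auto
    then have "(cmod \<alpha>)\<^sup>2 * ?Q x + (cmod \<beta>)\<^sup>2 * ?Q y > 0"
      proof
      assume "\<alpha> \<noteq> 0"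
      then show ?thesis
        using Q by (intro add_pos_nonneg) auto
    next
      assume "\<beta> \<noteq> 0"
      then show ?thesis
        using Q by (intro add_nonneg_pos) auto
    qed
    then have "(cmod (\<alpha> + \<beta>))\<^sup>2 * ?Q ((\<alpha> * x + \<beta> * y) / (\<alpha> + \<beta>)) > 0"
      unfolding eq using Re by linarith
    then show ?thesis
      using pos 1 zero_less_mult_pos by blast
  next
    case 2
    then have "?Q x \<ge> 0" "?Q y \<ge> 0"
      using assms by auto
    then have "(cmod (\<alpha> + \<beta>))\<^sup>2 * ?Q ((\<alpha> * x + \<beta> * y) / (\<alpha> + \<beta>)) \<ge> 0"
      unfolding eq using Re by simp
    then show ?thesis
      using pos 2 by (simp add: zero_le_mult_iff)
  qed
qed

text \<open>
  When \<open>A \<le> 0\<close>, a combination at infinity has form value at most 0, which forces all three terms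
  of the expansion to vanish. So the situation is confined to a half-plane with \<open>x\<close> and \<open>y\<close> on
  its boundary line.
\<close>

lemma circ_region_direction_at_infinity:
  assumes C: "circ_region A w D C" and "A \<le> 0" and "x \<in> C" "y \<in> C" "x \<noteq> y"
    and ab: "\<alpha> + \<beta> = 0" "\<alpha> \<noteq> 0" and Re: "Re (\<alpha> * cnj \<beta> * circ_polar A w D x y) \<ge> 0"
  shows "Re (\<alpha> * cnj \<beta> * circ_polar A w D x y) = 0" and "circ_polar A w D x y \<noteq> 0"
proof -
  let ?Q = "\<lambda>z. circ_form A w D z 1"
  have \<beta>: "\<beta> = - \<alpha>"
    using ab(1) by (simp add: eq_neg_iff_add_eq_0 add.commute)
  have Q: "?Q x \<ge> 0" "?Q y \<ge> 0"
    using assms unfolding circ_region_def by auto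
  have "A * (cmod (\<alpha> * x + \<beta> * y))\<^sup>2 =
      (cmod \<alpha>)\<^sup>2 * ?Q x + (cmod \<beta>)\<^sup>2 * ?Q y + 2 * Re (\<alpha> * cnj \<beta> * circ_polar A w D x y)"
    unfolding circ_form_combination[symmetric] ab by (simp add: circ_form_def)
  moreover have "A * (cmod (\<alpha> * x + \<beta> * y))\<^sup>2 \<le> 0"
    using \<open>A \<le> 0\<close> by (simp add: mult_nonpos_nonneg)
  moreover have "(cmod \<alpha>)\<^sup>2 * ?Q x \<ge> 0" "(cmod \<beta>)\<^sup>2 * ?Q y \<ge> 0"
    using Q by auto
  ultimately have *: "(cmod \<alpha>)\<^sup>2 * ?Q x = 0" "(cmod \<beta>)\<^sup>2 * ?Q y = 0"
      "A * (cmod (\<alpha> * x + \<beta> * y))\<^sup>2 = 0"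
    and **: "Re (\<alpha> * cnj \<beta> * circ_polar A w D x y) = 0"
    using Re by linarith+
  show "Re (\<alpha> * cnj \<beta> * circ_polar A w D x y) = 0"
    by (fact **)
  have "\<alpha> * x + \<beta> * y = \<alpha> * (x - y)"
    by (simp add: \<beta> algebra_simps)
  then have "A = 0"
    using *(3) ab(2) \<open>x \<noteq> y\<close> by simp
  then have "w \<noteq> 0"
    using C unfolding circ_region_def by auto
  \<comment> \<open>Both points lie on the boundary line, so the polarized form is a multiple of \<open>x - y\<close>.\<close>
  have "Re (cnj w * x) = - D" "Re (cnj w * y) = - D"
    using *(1,2) ab(2) \<beta> \<open>A = 0\<close> by (auto simp: circ_form_def)
  then have polar: "circ_polar A w D x y = cnj w * (x - y) / 2"
    unfolding circ_polar_def \<open>A = 0\<close> by (auto simp: complex_eq_iff field_simps)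
  show "circ_polar A w D x y \<noteq> 0"
    unfolding polar using \<open>w \<noteq> 0\<close> \<open>x \<noteq> y\<close> by simp
qed

section \<open>Two variables\<close>

text \<open>
  The homogenization of \<open>a + b x + c y + d x y\<close> as a bilinear form; it gives meaning to values at
  infinity.
\<close>

definition biaffine_hom ::
  "complex \<Rightarrow> complex \<Rightarrow> complex \<Rightarrow> complex \<Rightarrow> complex \<Rightarrow> complex \<Rightarrow> complex \<Rightarrow> complex \<Rightarrow> complex"
where
  "biaffine_hom a b c d u\<^sub>1 v\<^sub>1 u\<^sub>2 v\<^sub>2 = a * v\<^sub>1 * v\<^sub>2 + b * u\<^sub>1 * v\<^sub>2 + c * v\<^sub>1 * u\<^sub>2 + d * u\<^sub>1 * u\<^sub>2"

lemma biaffine_hom_finite: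
  assumes "v\<^sub>1 \<noteq> 0" "v\<^sub>2 \<noteq> 0"
  shows "biaffine_hom a b c d u\<^sub>1 v\<^sub>1 u\<^sub>2 v\<^sub>2 = v\<^sub>1 * v\<^sub>2 *
    (a + b * (u\<^sub>1 / v\<^sub>1) + c * (u\<^sub>2 / v\<^sub>2) + d * (u\<^sub>1 / v\<^sub>1) * (u\<^sub>2 / v\<^sub>2))"
  using assms by (simp add: biaffine_hom_def field_simps)

lemma biaffine_hom_infinite:
  "v\<^sub>2 \<noteq> 0 \<Longrightarrow> biaffine_hom a b c d u\<^sub>1 0 u\<^sub>2 v\<^sub>2 = u\<^sub>1 * v\<^sub>2 * (b + d * (u\<^sub>2 / v\<^sub>2))"
  "v\<^sub>1 \<noteq> 0 \<Longrightarrow> biaffine_hom a b c d u\<^sub>1 v\<^sub>1 u\<^sub>2 0 = v\<^sub>1 * u\<^sub>2 * (c + d * (u\<^sub>1 / v\<^sub>1))"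
  by (simp_all add: biaffine_hom_def field_simps)

text \<open>
  The heart of the proof. For \<open>A > 0\<close> the point at infinity is interior to \<open>C\<close>, and the
  hypothesis on \<open>b + d * m\<close> and \<open>c + d * m\<close> says that \<open>g\<close> has no zero with one coordinate at
  infinity and the other in \<open>C\<close>. The pair \<open>(\<infinity>, \<infinity>)\<close> is avoided by taking \<open>cmod l \<noteq> 1\<close>.
\<close>

lemma biaffine_swap_ratio_not_negative:
  assumes C: "circ_region A w D C"
    and g: "g = (\<lambda>x y. a + b * x + c * y + d * x * y)"
    and stable: "\<And>x y. x \<in> C \<Longrightarrow> y \<in> C \<Longrightarrow> g x y \<noteq> 0"
    and infinity: "A \<le> 0 \<or> (\<forall>m\<in>C. b + d * m \<noteq> 0 \<and> c + d * m \<noteq> 0)"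
    and x: "x \<in> C" and y: "y \<in> C" and \<rho>: "\<rho> > 0"
  shows "g y x \<noteq> - of_real \<rho> * g x y"
proof
  assume neg: "g y x = - of_real \<rho> * g x y"
  have "x \<noteq> y"
  proof
    assume "x = y"
    then have "g x x = - (of_real \<rho> * g x x)"
      using neg by simp
    then have "(1 + of_real \<rho>) * g x x = 0"
      by (simp add: distrib_right eq_neg_iff_add_eq_0)
    moreover have "1 + of_real \<rho> \<noteq> (0::complex)"
      using \<rho> by (auto simp: complex_eq_iff)
    ultimately show False
      using stable x by auto
  qed
  \<comment> \<open>The modulus of \<open>l\<close>: the value 1 would allow both points to be infinite for the same \<open>s\<close>;
    the other two values would allow both roots to correspond to points at infinity.\<close>
  have "infinite ({0<..} - {1, sqrt \<rho>, 1 / sqrt \<rho>})"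
    using infinite_Ioi by (intro Diff_infinite_finite) auto
  then have "{0<..} - {1, sqrt \<rho>, 1 / sqrt \<rho>} \<noteq> {}"
    by (rule infinite_imp_nonempty)
  then obtain \<mu> :: real where \<mu>: "\<mu> > 0" "\<mu> \<noteq> 1" "\<mu> \<noteq> sqrt \<rho>" "\<mu> \<noteq> 1 / sqrt \<rho>"
    by auto
  \<comment> \<open>The phase of \<open>l\<close> makes \<open>l * P\<close> nonnegative, so that the cross terms below have the sign of
    \<open>Re s\<close>.\<close>
  define P where "P = circ_polar A w D x y"
  define l where "l = of_real \<mu> * (if P = 0 then 1 else cnj P / of_real (cmod P))"
  have norm_l: "cmod l = \<mu>"
    using \<mu>(1) by (simp add: l_def norm_mult norm_divide)
  have lP: "l * P = of_real (\<mu> * cmod P)"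
    using complex_norm_square[of P] by (simp add: l_def field_simps power2_eq_square)
  have l0: "l \<noteq> 0"
    using norm_l \<mu>(1) by auto
  define q where "q s = l * g x y * s\<^sup>2 + (l\<^sup>2 * g x x + g y y) * s + l * g y x" for s
  have q: "q s = biaffine_hom a b c d (l * s * x + 1 * y) (l * s + 1) (l * x + s * y) (l + s)" for s
    unfolding q_def g biaffine_hom_def by (simp add: algebra_simps power2_eq_square)
  \<comment> \<open>Any root in the closed right half-plane gives a zero of \<open>g\<close> in \<open>C\<close>, unless \<open>C\<close> is a
    half-plane and one of the two points is infinite.\<close>
  have root: "Re s = 0 \<and> (l * s = - 1 \<or> s = - l)" if "q s = 0" "Re s \<ge> 0" for s
  proof -
    have Re_scale: "Re (s * of_real c) = Re s * c" "Re (cnj s * of_real c) = Re s * c" for c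
      by simp_all
    have "l * s * cnj 1 * P = s * of_real (\<mu> * cmod P)" "l * cnj s * P = cnj s * of_real (\<mu> * cmod P)"
      using lP by (simp_all add: mult_ac)
    then have Re: "Re (l * s * cnj 1 * P) = Re s * (\<mu> * cmod P)"
      "Re (l * cnj s * P) = Re s * (\<mu> * cmod P)"
      by (simp_all only: Re_scale)
    have Re0: "Re s * (\<mu> * cmod P) \<ge> 0"
      using that(2) \<mu>(1) by simp
    let ?z1 = "(l * s * x + 1 * y) / (l * s + 1)" and ?z2 = "(l * x + s * y) / (l + s)"
    have z1: "?z1 \<in> C" if "l * s + 1 \<noteq> 0"
      by (rule circ_region_combination[OF C x y that]) (use Re(1) Re0 P_def in simp)
    have z2: "?z2 \<in> C" if "l + s \<noteq> 0"
      by (rule circ_region_combination[OF C x y that]) (use Re(2) Re0 P_def in simp)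
    have inf: "l * s + 1 = 0 \<or> l + s = 0"
    proof (rule ccontr)
      assume fin: "\<not> ?thesis"
      then have "q s = (l * s + 1) * (l + s) * g ?z1 ?z2"
        unfolding q g using biaffine_hom_finite[of "l * s + 1" "l + s"] by blast
      then show False
        using that(1) fin z1 z2 stable by auto
    qed
    have not_both: "\<not> (l * s + 1 = 0 \<and> l + s = 0)"
    proof
      assume "l * s + 1 = 0 \<and> l + s = 0"
      then have "s = - l" "l * l = 1"
        by (auto simp: add_eq_0_iff)
      then have "\<mu> * \<mu> = 1"
        using norm_l by (metis norm_mult norm_one)
      then show False
        using \<mu>(1,2) by (auto simp: square_eq_1_iff)
    qed
    have "A \<le> 0"
    proof (rule ccontr)
      assume "\<not> A \<le> 0"
      then have lead: "b + d * m \<noteq> 0" "c + d * m \<noteq> 0" if "m \<in> C" for m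
        using infinity that by auto
      from inf show False
      proof
        assume i: "l * s + 1 = 0"
        then have fin: "l + s \<noteq> 0" and "l * s = - 1"
          using not_both by (auto simp: eq_neg_iff_add_eq_0)
        then have num: "l * s * x + 1 * y \<noteq> 0"
          using \<open>x \<noteq> y\<close> by simp
        have "q s = (l * s * x + 1 * y) * (l + s) * (b + d * ?z2)"
          unfolding q i by (rule biaffine_hom_infinite(1)[OF fin])
        then show False
          using that(1) num fin lead(1)[OF z2[OF fin]] by simp
      next
        assume i: "l + s = 0"
        then have fin: "l * s + 1 \<noteq> 0" and "s = - l"
          using not_both by (auto simp: add_eq_0_iff)
        then have "l * x + s * y = l * (x - y)"
          by (simp add: right_diff_distrib)
        then have num: "l * x + s * y \<noteq> 0"
          using \<open>x \<noteq> y\<close> l0 by simp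
        have "q s = (l * s + 1) * (l * x + s * y) * (c + d * ?z1)"
          unfolding q i by (rule biaffine_hom_infinite(2)[OF fin])
        then show False
          using that(1) num fin lead(2)[OF z1[OF fin]] by simp
      qed
    qed
    have "Re s * (\<mu> * cmod P) = 0 \<and> P \<noteq> 0"
      using inf
    proof
      assume i: "l * s + 1 = 0"
      then have "l * s \<noteq> 0"
        by auto
      from circ_region_direction_at_infinity[OF C \<open>A \<le> 0\<close> x y \<open>x \<noteq> y\<close> i this]
      show ?thesis
        using Re Re0 unfolding P_def by metis
    next
      assume i: "l + s = 0"
      from circ_region_direction_at_infinity[OF C \<open>A \<le> 0\<close> x y \<open>x \<noteq> y\<close> i l0]
      show ?thesis
        using Re Re0 unfolding P_def by metis
    qed
    then have "Re s = 0"
      using \<mu>(1) by auto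
    then show ?thesis
      using inf by (auto simp: eq_neg_iff_add_eq_0 add.commute)
  qed
  define e where "e = l * g x y"
  define m where "m = l\<^sup>2 * g x x + g y y"
  have e0: "e \<noteq> 0"
    using l0 stable x y by (simp add: e_def)
  have q': "q s = e * s\<^sup>2 + m * s - of_real \<rho> * e" for s
    unfolding q_def e_def m_def neg by (simp add: algebra_simps)
  \<comment> \<open>The quadratic formula gives one root \<open>s\<close>; the other one is \<open>- \<rho> / s\<close>.\<close>
  define s where "s = (csqrt (m\<^sup>2 + 4 * of_real \<rho> * e\<^sup>2) - m) / (2 * e)"
  have "2 * e * s + m = csqrt (m\<^sup>2 + 4 * of_real \<rho> * e\<^sup>2)"
    using e0 by (simp add: s_def)
  then have "(2 * e * s + m)\<^sup>2 = m\<^sup>2 + 4 * of_real \<rho> * e\<^sup>2"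
    by simp
  then have "4 * e * q s = 0"
    unfolding q' by (simp add: algebra_simps power2_eq_square)
  then have qs: "q s = 0"
    using e0 by simp
  have s0: "s \<noteq> 0"
    using qs e0 \<rho> by (auto simp: q')
  define t where "t = - of_real \<rho> / s"
  have "q t = - of_real \<rho> / s\<^sup>2 * q s"
    unfolding q' t_def using s0 by (simp add: field_simps power2_eq_square)
  then have qt: "q t = 0"
    using qs by simp
  have st: "s * t = - of_real \<rho>"
    using s0 by (simp add: t_def)
  have "Re t = - \<rho> / (cmod s)\<^sup>2 * Re s"
    unfolding t_def by (simp add: Re_divide cmod_power2)
  then have Re_t: "Re s \<le> 0 \<Longrightarrow> Re t \<ge> 0"
    using \<rho> by (simp add: divide_nonpos_nonneg mult_nonneg_nonpos)
  have Re_t0: "Re s = 0 \<longleftrightarrow> Re t = 0"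
    using \<open>Re t = _\<close> \<rho> s0 by simp
  \<comment> \<open>One of the roots has nonnegative real part, hence is exceptional, and then so is the other.\<close>
  have "Re s = 0"
    using root[OF qs] root[OF qt] Re_t Re_t0 by linarith
  then have s: "l * s = - 1 \<or> s = - l" and t: "l * t = - 1 \<or> t = - l"
    using root[OF qs] root[OF qt] Re_t0 by auto
  have prod: "(l * s) * (l * t) = - of_real \<rho> * l\<^sup>2"
    unfolding st[symmetric] by (simp add: power2_eq_square)
  from s t consider "l * s = - 1" "l * t = - 1" | "s = - l" "t = - l" | "s * t = 1"
    by (elim disjE) (auto simp: mult.commute)
  then show False
  proof cases
    case 1
    then have "\<rho> * \<mu>\<^sup>2 = 1"
      using arg_cong[OF prod, of cmod] \<rho> by (simp add: norm_mult norm_power norm_l)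
    then have "\<mu>\<^sup>2 = 1 / \<rho>"
      using \<rho> by (simp add: field_simps)
    then have "\<mu> = 1 / sqrt \<rho>"
      using real_sqrt_unique[of \<mu>] \<mu>(1) by (simp add: real_sqrt_divide)
    then show ?thesis
      using \<mu> by simp
  next
    case 2
    then have ll: "l * l = - of_real \<rho>"
      using st by simp
    have "\<mu>\<^sup>2 = \<rho>"
      using arg_cong[OF ll, of cmod] \<rho> by (simp add: norm_mult norm_l power2_eq_square)
    then have "\<mu> = sqrt \<rho>"
      using real_sqrt_unique[of \<mu>] \<mu>(1) by simp
    then show ?thesis
      using \<mu> by simp
  next
    case 3
    then show ?thesis
      using st \<rho> by (auto simp: complex_eq_iff)
  qed
qed

section \<open>Functions that are affine in each variable\<close>

text \<open>For a function that is affine in the variable \<open>k\<close>, this is its partial derivative.\<close>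

definition slope :: "(('n \<Rightarrow> complex) \<Rightarrow> complex) \<Rightarrow> 'n \<Rightarrow> ('n \<Rightarrow> complex) \<Rightarrow> complex" where
  "slope F k z = F (z(k := 1)) - F (z(k := 0))"

definition affine_in_each :: "(('n \<Rightarrow> complex) \<Rightarrow> complex) \<Rightarrow> bool" where
  "affine_in_each F \<longleftrightarrow> (\<forall>z k x. F (z(k := x)) = F (z(k := 0)) + x * slope F k z)"

lemma affine_in_eachD:
  "affine_in_each F \<Longrightarrow> F (z(k := x)) = F (z(k := 0)) + x * slope F k z"
  unfolding affine_in_each_def by blast

lemma slope_upd_same [simp]: "slope F k (z(k := x)) = slope F k z"
  by (simp add: slope_def)

lemma affine_in_each_slope:
  assumes "affine_in_each F"
  shows "affine_in_each (slope F i)"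
  unfolding affine_in_each_def
proof (intro allI)
  fix z k x
  show "slope F i (z(k := x)) = slope F i (z(k := 0)) + x * slope (slope F i) k z"
  proof (cases "k = i")
    case True
    then show ?thesis
      by (simp add: slope_def)
  next
    case False
    have eq: "F (z(k := x, i := v)) = F (z(k := 0, i := v)) + x * slope F k (z(i := v))" for v
      using affine_in_eachD[OF assms, of "z(i := v)" k x] by (simp only: fun_upd_twist[OF False])
    have "slope F i (z(k := x)) = slope F i (z(k := 0)) +
        x * (slope F k (z(i := 1)) - slope F k (z(i := 0)))"
      unfolding slope_def[of F i] eq by (simp add: algebra_simps)
    moreover have "slope (slope F i) k z = slope F k (z(i := 1)) - slope F k (z(i := 0))"
      by (simp add: slope_def fun_upd_twist[OF False])
    ultimately show ?thesis
      by simp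
  qed
qed

text \<open>
  An affine function of one variable with two zeros vanishes; releasing the variables from their
  sets \<open>S k\<close> one at a time proves the claim.
\<close>

lemma affine_in_each_eq_0:
  fixes F :: "('n::finite \<Rightarrow> complex) \<Rightarrow> complex"
  assumes F: "affine_in_each F"
    and S: "\<And>k. u k \<in> S k" "\<And>k. v k \<in> S k" "\<And>k. u k \<noteq> v k"
    and zero: "\<And>z. (\<And>k. z k \<in> S k) \<Longrightarrow> F z = 0"
  shows "F z = 0"
proof -
  have "\<forall>z. (\<forall>k. k \<notin> J \<longrightarrow> z k \<in> S k) \<longrightarrow> F z = 0" if "finite J" for J
    using that
  proof induction
    case empty
    then show ?case
      using zero by auto
  next
    case (insert j J)
    show ?case
    proof (intro allI impI)
      fix z
      assume z: "\<forall>k. k \<notin> insert j J \<longrightarrow> z k \<in> S k"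
      have "F (z(j := u j)) = 0" "F (z(j := v j)) = 0"
        using z S by (auto intro!: insert.IH[rule_format])
      then have "F (z(j := 0)) + u j * slope F j z = 0" "F (z(j := 0)) + v j * slope F j z = 0"
        by (simp_all only: affine_in_eachD[OF F, of z j "u j"] affine_in_eachD[OF F, of z j "v j"])
      then have "(u j - v j) * slope F j z = 0"
        by (simp add: algebra_simps add_eq_0_iff)
      then have "slope F j z = 0"
        using S(3)[of j] by simp
      then have "F (z(j := z j)) = F (z(j := u j))"
        using affine_in_eachD[OF F, of z j "z j"] affine_in_eachD[OF F, of z j "u j"]
        by (simp del: fun_upd_triv)
      then show "F z = 0"
        using \<open>F (z(j := u j)) = 0\<close> by simp
    qed
  qed
  from this[of UNIV] show ?thesis
    by simp
qed

text \<open>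
  Suppose the slope vanishes at \<open>z\<close>. As it is not identically zero and the coordinates of \<open>z\<close>
  are limit points of \<open>C\<close>, there are points \<open>X\<close> with coordinates in \<open>C\<close>, arbitrarily near \<open>z\<close>,
  where it does not vanish (\<open>affine_in_each_eq_0\<close>). There \<open>F\<close>, as a function of the variable \<open>i\<close>, has the
  zero \<open>- F (X(i := 0)) / slope F i X\<close>, which must lie outside \<open>C\<close> and hence is bounded. In the
  limit this bounds \<open>F (z(i := 0))\<close> by 0, so \<open>F z = 0\<close>, against stability.
\<close>

lemma slope_nonzero_on_unbounded:
  fixes F :: "('n::finite \<Rightarrow> complex) \<Rightarrow> complex"
  assumes F: "affine_in_each F"
    and cont: "\<And>X z. (\<And>k. (\<lambda>n. X n k) \<longlonglongrightarrow> z k) \<Longrightarrow> (\<lambda>n. F (X n)) \<longlonglongrightarrow> F z"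
    and limpt: "\<And>x. x \<in> C \<Longrightarrow> x islimpt C" and bdd: "bounded (- C)"
    and stable: "\<And>z. (\<And>k. z k \<in> C) \<Longrightarrow> F z \<noteq> 0"
    and depends: "slope F i z\<^sub>0 \<noteq> 0"
    and z: "\<And>k. z k \<in> C"
  shows "slope F i z \<noteq> 0"
proof
  assume slope0: "slope F i z = 0"
  obtain R where R: "\<And>x. x \<notin> C \<Longrightarrow> cmod x \<le> R"
    using bdd by (auto simp: bounded_iff)
  have near: "\<exists>X. (\<forall>k. X k \<in> C \<and> dist (X k) (z k) < \<epsilon>) \<and> slope F i X \<noteq> 0" if "\<epsilon> > 0" for \<epsilon>
  proof (rule ccontr)
    assume none: "\<not> ?thesis"
    have "\<exists>v. v \<in> C \<and> v \<noteq> z k \<and> dist v (z k) < \<epsilon>" for k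
      using limpt[OF z] that by (auto simp: islimpt_approachable)
    then obtain v where v: "\<And>k. v k \<in> C \<and> v k \<noteq> z k \<and> dist (v k) (z k) < \<epsilon>"
      by metis
    have "slope F i z\<^sub>0 = 0"
    proof (rule affine_in_each_eq_0[OF affine_in_each_slope[OF F],
          where S = "\<lambda>k. {x \<in> C. dist x (z k) < \<epsilon>}" and u = z and v = v])
      show "z k \<noteq> v k" for k
        using v by metis
      show "slope F i X = 0" if "\<And>k. X k \<in> {x \<in> C. dist x (z k) < \<epsilon>}" for X
        using none that by auto
    qed (use v z that in auto)
    with depends show False
      by simp
  qed
  have "\<forall>n. \<exists>X. (\<forall>k. X k \<in> C \<and> dist (X k) (z k) < inverse (real (Suc n))) \<and> slope F i X \<noteq> 0"
    using near by simp
  then obtain X where X: "\<And>n k. X n k \<in> C" "\<And>n k. dist (X n k) (z k) < inverse (real (Suc n))"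
    "\<And>n. slope F i (X n) \<noteq> 0"
    by metis
  have Xz: "(\<lambda>n. X n k) \<longlonglongrightarrow> z k" for k
    unfolding tendsto_dist_iff[of _ "z k"]
    by (rule tendsto_sandwich[OF _ _ tendsto_const LIMSEQ_inverse_real_of_nat])
       (use X(2) in \<open>auto intro!: always_eventually less_imp_le\<close>)
  have upd: "(\<lambda>n. F ((X n)(i := c))) \<longlonglongrightarrow> F (z(i := c))" for c
    by (rule cont) (use Xz in auto)
  have bound: "cmod (F ((X n)(i := 0))) \<le> R * cmod (slope F i (X n))" for n
  proof -
    let ?x = "- F ((X n)(i := 0)) / slope F i (X n)"
    have "F ((X n)(i := ?x)) = 0"
      using affine_in_eachD[OF F, of "X n" i ?x] X(3) by simp
    then have "\<exists>k. ((X n)(i := ?x)) k \<notin> C"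
      using stable[of "(X n)(i := ?x)"] by blast
    then have "?x \<notin> C"
      using X(1) by (auto split: if_splits)
    then show ?thesis
      using R[of ?x] X(3) by (simp add: norm_divide divide_le_eq)
  qed
  have "(\<lambda>n. cmod (F ((X n)(i := 0)))) \<longlonglongrightarrow> cmod (F (z(i := 0)))"
    by (intro tendsto_intros upd)
  moreover have "(\<lambda>n. R * cmod (slope F i (X n))) \<longlonglongrightarrow> R * cmod (slope F i z)"
    unfolding slope_def by (intro tendsto_intros upd)
  ultimately have "cmod (F (z(i := 0))) \<le> R * cmod (slope F i z)"
    by (rule LIMSEQ_le) (use bound in blast)
  then have "F (z(i := 0)) = 0"
    using slope0 by simp
  then have "F z = 0"
    using affine_in_eachD[OF F, of z i "z i"] slope0 by simp
  with stable z show False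
    by blast
qed

section \<open>Multi-affine polynomials\<close>

lemma multi_affine_exponent_le_1:
  assumes "multi_affine f" "m \<in> Poly_Mapping.keys f"
  shows "Poly_Mapping.lookup m k \<le> 1"
proof -
  have "Poly_Mapping.lookup m k \<le> degree_in k f"
    unfolding degree_in_def using assms(2) by (intro Max_ge) auto
  then show ?thesis
    using assms(1) unfolding multi_affine_def by (meson le_trans)
qed

lemma affine_in_each_cpoly_eval:
  assumes "multi_affine f"
  shows "affine_in_each (cpoly_eval f)"
  unfolding affine_in_each_def
proof (intro allI)
  fix z k x
  have "monom_eval m (z(k := x)) =
      monom_eval m (z(k := 0)) + x * (monom_eval m (z(k := 1)) - monom_eval m (z(k := 0)))"
    if "m \<in> Poly_Mapping.keys f" for m
  proof -
    have split: "monom_eval m (z(k := x)) =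
        x ^ Poly_Mapping.lookup m k * (\<Prod>i\<in>UNIV - {k}. z i ^ Poly_Mapping.lookup m i)" for x
      unfolding monom_eval_def by (subst prod.remove[of _ k]) (auto intro!: prod.cong)
    have "Poly_Mapping.lookup m k = 0 \<or> Poly_Mapping.lookup m k = 1"
      using multi_affine_exponent_le_1[OF assms that, of k] by linarith
    then show ?thesis
      unfolding split by auto
  qed
  then have "cpoly_eval f (z(k := x)) = (\<Sum>m\<in>Poly_Mapping.keys f. Poly_Mapping.lookup f m *
      (monom_eval m (z(k := 0)) + x * (monom_eval m (z(k := 1)) - monom_eval m (z(k := 0)))))"
    unfolding cpoly_eval_def by (intro sum.cong) auto
  also have "\<dots> = cpoly_eval f (z(k := 0)) + x * slope (cpoly_eval f) k z"
    unfolding cpoly_eval_def slope_def sum_subtractf[symmetric] sum_distrib_left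
      sum.distrib[symmetric]
    by (intro sum.cong) (auto simp: algebra_simps)
  finally show "cpoly_eval f (z(k := x)) = cpoly_eval f (z(k := 0)) + x * slope (cpoly_eval f) k z" .
qed

lemma tendsto_cpoly_eval:
  assumes "\<And>k. (\<lambda>n. X n k) \<longlonglongrightarrow> z k"
  shows "(\<lambda>n. cpoly_eval f (X n)) \<longlonglongrightarrow> cpoly_eval f z"
  unfolding cpoly_eval_def monom_eval_def by (intro tendsto_intros assms)

text \<open>
  Evaluation at the indicator function of a set \<open>K\<close> keeps the coefficients of the monomials with
  support in \<open>K\<close>. If \<open>K\<close> is the support of a monomial of least degree among those containing
  \<open>z\<^sub>i\<close>, the slope at that point picks out a single nonzero coefficient.
\<close>

lemma depends_on_imp_slope_nonzero:
  fixes f :: "'n::finite cpoly"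
  assumes f: "multi_affine f" and "depends_on f i"
  shows "\<exists>z. slope (cpoly_eval f) i z \<noteq> 0"
proof -
  have "\<exists>m. m \<in> Poly_Mapping.keys f \<and> i \<in> Poly_Mapping.keys m"
  proof (rule ccontr)
    assume "\<not> ?thesis"
    then have "partial_deriv i f = 0"
      unfolding partial_deriv_def by (intro sum.neutral) (auto simp: in_keys_iff)
    then show False
      using assms(2) unfolding depends_on_def by simp
  qed
  then obtain m where m: "m \<in> Poly_Mapping.keys f" "i \<in> Poly_Mapping.keys m"
    and least: "\<And>m'. m' \<in> Poly_Mapping.keys f \<Longrightarrow> i \<in> Poly_Mapping.keys m' \<Longrightarrow>
      card (Poly_Mapping.keys m) \<le> card (Poly_Mapping.keys m')"
    using ex_has_least_nat[of "\<lambda>m. m \<in> Poly_Mapping.keys f \<and> i \<in> Poly_Mapping.keys m" _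
        "\<lambda>m. card (Poly_Mapping.keys m)"] by blast
  have ev: "monom_eval m' (indicator K) = (if Poly_Mapping.keys m' \<subseteq> K then 1 else 0)"
    for m' :: "'n monomial" and K
  proof (cases "Poly_Mapping.keys m' \<subseteq> K")
    case True
    then have "Poly_Mapping.lookup m' k = 0" if "k \<notin> K" for k
      using that by (auto simp flip: not_in_keys_iff_lookup_eq_zero)
    then have "indicator K k ^ Poly_Mapping.lookup m' k = (1 :: complex)" for k
      by (cases "k \<in> K") auto
    then show ?thesis
      using True by (simp add: monom_eval_def)
  next
    case False
    then obtain k where "k \<in> Poly_Mapping.keys m'" "k \<notin> K"
      by auto
    then show ?thesis
      using False unfolding monom_eval_def by (auto simp: in_keys_iff intro!: bexI[of _ k])
  qed
  let ?K = "Poly_Mapping.keys m"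
  have upd: "(indicator ?K)(i := 1) = (indicator ?K :: 'n \<Rightarrow> complex)"
    "(indicator ?K)(i := 0) = (indicator (?K - {i}) :: 'n \<Rightarrow> complex)"
    using m(2) by (auto simp: indicator_def)
  have "monom_eval m' (indicator ?K) - monom_eval m' (indicator (?K - {i})) =
      (if m' = m then 1 else (0 :: complex))" if m': "m' \<in> Poly_Mapping.keys f" for m'
  proof -
    have "m' = m" if sub: "Poly_Mapping.keys m' \<subseteq> ?K" and i: "i \<in> Poly_Mapping.keys m'"
    proof -
      have "Poly_Mapping.keys m' = ?K"
        using sub least[OF m' i] by (intro card_seteq) auto
      moreover have "Poly_Mapping.lookup m' k = (if k \<in> Poly_Mapping.keys m' then 1 else 0)"
        "Poly_Mapping.lookup m k = (if k \<in> ?K then 1 else 0)" for k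
        using multi_affine_exponent_le_1[OF f m', of k] multi_affine_exponent_le_1[OF f m(1), of k]
        by (auto simp: in_keys_iff)
      ultimately show ?thesis
        by (intro poly_mapping_eqI) simp
    qed
    then show ?thesis
      unfolding ev using m(2) by auto
  qed
  then have "slope (cpoly_eval f) i (indicator ?K) =
      (\<Sum>m'\<in>Poly_Mapping.keys f. Poly_Mapping.lookup f m' * (if m' = m then 1 else 0))"
    unfolding slope_def upd cpoly_eval_def sum_subtractf[symmetric] right_diff_distrib[symmetric]
    by (intro sum.cong) auto
  also have "\<dots> = Poly_Mapping.lookup f m"
    using m(1) by (simp add: mult_delta_right)
  also have "\<dots> \<noteq> 0"
    using m(1) by (simp add: in_keys_iff)
  finally show ?thesis
    by blast
qed

section \<open>Mixing a polynomial with its transposition\<close>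

text \<open>
  The two cases of the theorem differ only in how the leading coefficients are controlled, which
  the last hypothesis abstracts.
\<close>

lemma stable_on_mix_transpose:
  fixes f :: "'n::finite cpoly"
  assumes f: "multi_affine f" and C: "circ_region A w D C" and stable: "stable_on C f"
    and p: "0 \<le> p" "p \<le> 1" and ij: "i \<noteq> j"
    and infinity: "A \<le> 0 \<or> (\<forall>z. (\<forall>k. z k \<in> C) \<longrightarrow>
       slope (cpoly_eval f) i z \<noteq> 0 \<and> slope (cpoly_eval f) j z \<noteq> 0)"
  shows "stable_on C (const (of_real p) * f +
    const (1 - of_real p) * permute_vars (Transposition.transpose i j) f)"
  unfolding stable_on_def
proof (intro allI impI notI)
  fix z :: "'n \<Rightarrow> complex"
  assume z: "\<forall>k. z k \<in> C"
  define F where "F = cpoly_eval f"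
  define g where "g x y = F (z(i := x, j := y))" for x y
  define b where "b = slope F i (z(j := 0))"
  define d where "d = slope (slope F i) j z"
  define c where "c = slope F j (z(i := 0))"
  define a where "a = g 0 0"
  have F: "affine_in_each F"
    unfolding F_def by (rule affine_in_each_cpoly_eval[OF f])
  have slope_i: "slope F i (z(j := y)) = b + d * y" for y
    unfolding b_def d_def using affine_in_eachD[OF affine_in_each_slope[OF F], of i z j y]
    by (simp add: mult.commute)
  have slope_j: "slope F j (z(i := x)) = c + d * x" for x
  proof -
    have "slope (slope F j) i z = d"
      unfolding d_def slope_def using ij by (simp add: fun_upd_twist)
    then show ?thesis
      unfolding c_def using affine_in_eachD[OF affine_in_each_slope[OF F], of j z i x]
      by (simp add: mult.commute)
  qed
  have g: "g = (\<lambda>x y. a + b * x + c * y + d * x * y)"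
  proof (intro ext)
    fix x y
    have "g x y = F (z(i := x, j := 0)) + y * slope F j (z(i := x))"
      unfolding g_def by (rule affine_in_eachD[OF F])
    moreover have "F (z(i := x, j := 0)) = a + x * b"
      using affine_in_eachD[OF F, of "z(j := 0)" i x] ij
      by (simp add: a_def b_def g_def fun_upd_twist)
    ultimately show "g x y = a + b * x + c * y + d * x * y"
      by (simp add: slope_j algebra_simps)
  qed
  have g0: "g x y \<noteq> 0" if "x \<in> C" "y \<in> C" for x y
    using stable that z unfolding g_def F_def stable_on_def by auto
  have inf: "A \<le> 0 \<or> (\<forall>m\<in>C. b + d * m \<noteq> 0 \<and> c + d * m \<noteq> 0)"
    using infinity
  proof
    assume *: "\<forall>z. (\<forall>k. z k \<in> C) \<longrightarrow>
       slope (cpoly_eval f) i z \<noteq> 0 \<and> slope (cpoly_eval f) j z \<noteq> 0"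
    have "b + d * m \<noteq> 0 \<and> c + d * m \<noteq> 0" if "m \<in> C" for m
      unfolding slope_i[symmetric] slope_j[symmetric]
      using *[rule_format, of "z(j := m)"] *[rule_format, of "z(i := m)"] z that
      by (simp add: F_def)
    then show ?thesis
      by blast
  qed blast
  have "(\<lambda>k. z (Transposition.transpose i j k)) = z(i := z j, j := z i)"
    using ij by (auto simp: Transposition.transpose_def)
  moreover assume "cpoly_eval (const (of_real p) * f +
      const (1 - of_real p) * permute_vars (Transposition.transpose i j) f) z = 0"
  ultimately have mix: "of_real p * g (z i) (z j) + (1 - of_real p) * g (z j) (z i) = 0"
    unfolding g_def F_def
    by (simp add: cpoly_eval_add cpoly_eval_mult cpoly_eval_permute_vars)
  have ne: "g (z i) (z j) \<noteq> 0" "g (z j) (z i) \<noteq> 0"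
    using g0 z by auto
  have "p \<noteq> 0" "p \<noteq> 1"
    using mix ne by auto
  then have p01: "0 < p" "p < 1"
    using p by auto
  then have "1 - of_real p \<noteq> (0::complex)"
    by (auto simp: complex_eq_iff)
  then have "g (z j) (z i) = - of_real (p / (1 - p)) * g (z i) (z j)"
    using mix by (simp add: field_simps add_eq_0_iff)
  moreover have "p / (1 - p) > 0"
    using p01 by simp
  ultimately show False
    using biaffine_swap_ratio_not_negative[OF C g g0 inf] z by blast
qed

theorem proposition1p3:
  fixes f :: "'n::finite cpoly" and C :: "complex set" and p :: real and i j :: 'n
  assumes "multi_affine f"
    and "circular_domain C"
    and "0 \<le> p" and "p \<le> 1"
    and "i \<noteq> j"
  defines "\<tau> \<equiv> Transposition.transpose i j"
  shows "(convex C \<and> stable_on C f \<longrightarrow>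
            stable_on C (const (of_real p) * f + const (1 - of_real p) * permute_vars \<tau> f)) \<and>
         (\<not> convex C \<and> stable_on C f \<and> depends_on f i \<and> depends_on f j \<longrightarrow>
            stable_on C (const (of_real p) * f + const (1 - of_real p) * permute_vars \<tau> f))"
  using assms(2)
proof (cases rule: circular_domain_cases)
  case (convex A w D)
  then show ?thesis
    unfolding \<tau>_def using stable_on_mix_transpose[OF assms(1) convex(1)] assms(3-5) by blast
next
  case (exterior A w D a r)
  have "bounded (- C)"
    using exterior(3) by auto
  have "slope (cpoly_eval f) k z \<noteq> 0"
    if hyps: "stable_on C f" "depends_on f k" "\<forall>k. z k \<in> C" for k z
  proof -
    obtain z\<^sub>0 where z0: "slope (cpoly_eval f) k z\<^sub>0 \<noteq> 0"
      using depends_on_imp_slope_nonzero[OF assms(1) hyps(2)] by blast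
    show ?thesis
    proof (rule slope_nonzero_on_unbounded[where C = C])
      show "affine_in_each (cpoly_eval f)"
        by (rule affine_in_each_cpoly_eval[OF assms(1)])
      show "(\<lambda>n. cpoly_eval f (X n)) \<longlonglongrightarrow> cpoly_eval f y"
        if "\<And>k. (\<lambda>n. X n k) \<longlonglongrightarrow> y k" for X y
        using that by (rule tendsto_cpoly_eval)
      show "x islimpt C" if "x \<in> C" for x
        using exterior(2,3) that by (rule islimpt_exterior)
      show "cpoly_eval f y \<noteq> 0" if "\<And>k. y k \<in> C" for y
        using hyps(1) that unfolding stable_on_def by blast
    qed (use hyps(3) \<open>bounded (- C)\<close> z0 in auto)
  qed
  then show ?thesis
    unfolding \<tau>_def using stable_on_mix_transpose[OF assms(1) exterior(1)] assms(3-5) exterior(4)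
    by blast
qed

end
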